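(* Let $(K,P,N)$ be a finite element of class $C^k$ with nodes $N=(n_1,\dots,n_\nu)^T$, let $\tilde P\subset C_b^k(K)$ be a finite-dimensional function space with $P\subset\tilde P$, and let $\lambda_1,\dots,\lambda_\kappa\in C_b^k(K)'$ be functionals, linearly independent as functionals on $\tilde P$, such that $P=\bigcap_{i=1}^\kappa\{p\in\tilde P:\lambda_i(p)=0\}$. Let $(K,\tilde P,\tilde N)$ be the finite element with nodes ordered as $$\tilde N=\begin{bmatrix}N\\ L\end{bmatrix},\qquad L_i=\lambda_i\ \text{ for } 1\le i\le\kappa,$$ and let $\{\tilde\psi_i\}_{i=1}^{\nu+\kappa}$ be the nodal basis for $(K,\tilde P,\tilde N)$. Then $\{\tilde\psi_i\}_{i=1}^\nu$ is the nodal basis for $(K,P,N)$.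
   Context: For a bounded domain $\Omega\subset\mathbb{R}^d$, $C_b^k(\Omega)$ is the space of functions on $\Omega$ with continuous and bounded derivatives up to and including order $k$, and $C_b^k(\Omega)'$ is its topological dual. A finite element (of class $C^k$) is a triple $(K,P,N)$ where $K\subset\mathbb{R}^d$ is a bounded domain, $P\subset C_b^k(K)$ is a finite-dimensional function space of dimension $\nu$, and $N=\{n_i\}_{i=1}^\nu\subset C_b^k(K)'$ is a collection of linearly independent functionals whose restrictions to $P$ form a basis of $P'$. The nodal basis of a finite element $(K,P,N)$ is the set $\{\psi_i\}_{i=1}^{\nu}\subset P$ with $n_i(\psi_j)=\delta_{ij}$ for $1\le i,j\le\nu$. Under the hypotheses of the claim, $(K,\tilde P,\tilde N)$ is indeed a finite element, with $\dim\tilde P=\nu+\kappa$. *)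

theory Defs
  imports "HOL-Analysis.Analysis" "HOL-Library.Function_Algebras"
begin

section \<open>The vector space of real-valued functions\<close>

text \<open>
  With pointwise operations, the library notions \<open>subspace\<close>, \<open>span\<close>, \<open>dim\<close> and \<open>independent\<close>
  apply both to spaces of functions and to spaces of functionals.
\<close>

instantiation "fun" :: (type, real_vector) real_vector
begin

definition scaleR_fun_def: "c *\<^sub>R f = (\<lambda>x. c *\<^sub>R f x)"

instance
  by standard (auto simp: scaleR_fun_def plus_fun_def fun_eq_iff algebra_simps)

end

lemma scaleR_fun_apply [simp]: "(c *\<^sub>R f) x = c *\<^sub>R f x"
  by (simp add: scaleR_fun_def)


section \<open>The space of functions with bounded continuous derivatives\<close>

definition partial_deriv :: "'d \<Rightarrow> (real ^ 'd \<Rightarrow> real) \<Rightarrow> real ^ 'd \<Rightarrow> real" where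
  "partial_deriv i f x = deriv (\<lambda>t. f (x + t *\<^sub>R axis i 1)) 0"

primrec iter_deriv :: "'d list \<Rightarrow> (real ^ 'd \<Rightarrow> real) \<Rightarrow> real ^ 'd \<Rightarrow> real" where
  "iter_deriv [] f = f"
| "iter_deriv (i # is) f = partial_deriv i (iter_deriv is f)"

text \<open>
  A function on \<open>K\<close> is represented by its extension by zero to the whole space, so that equality
  of representatives is equality on \<open>K\<close>. All derivatives are only considered at points of \<open>K\<close>;
  since \<open>K\<close> is open wherever these notions are used, they do not depend on the extension.
\<close>

definition Cb :: "nat \<Rightarrow> (real ^ 'd) set \<Rightarrow> (real ^ 'd \<Rightarrow> real) set" where
  "Cb k K = {f. (\<forall>x. x \<notin> K \<longrightarrow> f x = 0)
     \<and> (\<forall>is i. length is < k \<longrightarrow>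
          (\<forall>x\<in>K. (\<lambda>t. iter_deriv is f (x + t *\<^sub>R axis i 1)) differentiable (at 0)))
     \<and> (\<forall>is. length is \<le> k \<longrightarrow>
          continuous_on K (iter_deriv is f) \<and> bounded (iter_deriv is f ` K))}"

definition Cb_norm :: "nat \<Rightarrow> (real ^ 'd) set \<Rightarrow> (real ^ 'd \<Rightarrow> real) \<Rightarrow> real" where
  "Cb_norm k K f = (MAX is\<in>{is. length is \<le> k}. SUP x\<in>K. \<bar>iter_deriv is f x\<bar>)"

text \<open>The value outside \<open>Cb k K\<close> is irrelevant; it makes the locale \<open>Metric_space\<close> applicable.\<close>

definition Cb_dist ::
    "nat \<Rightarrow> (real ^ 'd) set \<Rightarrow> (real ^ 'd \<Rightarrow> real) \<Rightarrow> (real ^ 'd \<Rightarrow> real) \<Rightarrow> real" where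
  "Cb_dist k K f g = (if f \<in> Cb k K \<and> g \<in> Cb k K then Cb_norm k K (f - g) else 0)"

definition Cb_topology :: "nat \<Rightarrow> (real ^ 'd) set \<Rightarrow> (real ^ 'd \<Rightarrow> real) topology" where
  "Cb_topology k K = Metric_space.mtopology (Cb k K) (Cb_dist k K)"


section \<open>Dual spaces\<close>

text \<open>
  Functionals on a subspace \<open>V\<close> are likewise extended by zero, so that \<open>restrict_to V l\<close> represents
  the restriction of \<open>l\<close> to \<open>V\<close>.
\<close>

definition restrict_to :: "'a set \<Rightarrow> ('a \<Rightarrow> real) \<Rightarrow> 'a \<Rightarrow> real" where
  "restrict_to V l = (\<lambda>f. if f \<in> V then l f else 0)"

text \<open>
  The topological dual of a subspace \<open>V\<close> of \<open>Cb k K\<close>. The case \<open>V = Cb k K\<close> is the dual of the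
  whole space; for finite-dimensional \<open>V\<close> this is the usual dual space of \<open>V\<close>.
\<close>

definition top_dual ::
    "nat \<Rightarrow> (real ^ 'd) set \<Rightarrow> (real ^ 'd \<Rightarrow> real) set \<Rightarrow> ((real ^ 'd \<Rightarrow> real) \<Rightarrow> real) set" where
  "top_dual k K V = {l. (\<forall>f. f \<notin> V \<longrightarrow> l f = 0)
     \<and> (\<forall>f\<in>V. \<forall>g\<in>V. l (f + g) = l f + l g)
     \<and> (\<forall>c. \<forall>f\<in>V. l (c *\<^sub>R f) = c * l f)
     \<and> continuous_map (subtopology (Cb_topology k K) V) euclideanreal l}"

definition lin_indep :: "'a::real_vector list \<Rightarrow> bool" where
  "lin_indep xs \<longleftrightarrow> distinct xs \<and> independent (set xs)"


section \<open>Finite elements\<close>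

definition bounded_domain :: "(real ^ 'd) set \<Rightarrow> bool" where
  "bounded_domain K \<longleftrightarrow> open K \<and> connected K \<and> K \<noteq> {} \<and> bounded K"

definition fin_dim_subspace :: "'a::real_vector set \<Rightarrow> bool" where
  "fin_dim_subspace V \<longleftrightarrow> subspace V \<and> (\<exists>B. finite B \<and> V = span B)"

text \<open>The list \<open>N\<close> of nodes has indices \<open>0, \<dots>, \<nu> - 1\<close> instead of \<open>1, \<dots>, \<nu>\<close>.\<close>

definition finite_element ::
    "nat \<Rightarrow> (real ^ 'd) set \<Rightarrow> (real ^ 'd \<Rightarrow> real) set
      \<Rightarrow> ((real ^ 'd \<Rightarrow> real) \<Rightarrow> real) list \<Rightarrow> bool" where
  "finite_element k K P N \<longleftrightarrow>
     bounded_domain K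
     \<and> fin_dim_subspace P \<and> P \<subseteq> Cb k K \<and> dim P = length N
     \<and> set N \<subseteq> top_dual k K (Cb k K) \<and> lin_indep N
     \<and> lin_indep (map (restrict_to P) N)
     \<and> span (set (map (restrict_to P) N)) = top_dual k K P"

definition nodal_basis ::
    "(real ^ 'd \<Rightarrow> real) set \<Rightarrow> ((real ^ 'd \<Rightarrow> real) \<Rightarrow> real) list
      \<Rightarrow> (real ^ 'd \<Rightarrow> real) list \<Rightarrow> bool" where
  "nodal_basis P N \<psi> \<longleftrightarrow>
     length \<psi> = length N \<and> set \<psi> \<subseteq> P
     \<and> (\<forall>i<length N. \<forall>j<length N. (N ! i) (\<psi> ! j) = (if i = j then 1 else 0))"


section \<open>The norm on \<open>Cb k K\<close> induces a metric\<close>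

lemma Cb_dirD:
  assumes "f \<in> Cb k K" "length is < k" "x \<in> K"
  shows "(\<lambda>t. iter_deriv is f (x + t *\<^sub>R axis i 1)) field_differentiable (at 0)"
  using assms by (auto simp: Cb_def field_differentiable_def real_differentiable_def)

lemma line_eventually:
  fixes K :: "(real ^ 'd) set"
  assumes "open K" "x \<in> K"
  shows "\<forall>\<^sub>F t in nhds (0::real). x + t *\<^sub>R v \<in> K"
proof -
  have "((\<lambda>t. x + t *\<^sub>R v) \<longlongrightarrow> x + 0 *\<^sub>R v) (nhds (0::real))"
    by (intro tendsto_intros filterlim_ident)
  then have "((\<lambda>t. x + t *\<^sub>R v) \<longlongrightarrow> x) (nhds (0::real))" by simp
  from topological_tendstoD[OF this assms] show ?thesis .
qed

lemma iter_deriv_lin: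
  assumes K: "open K" and f: "f \<in> Cb k K" and g: "g \<in> Cb k K"
  shows "length is \<le> k \<Longrightarrow> x \<in> K \<Longrightarrow>
     iter_deriv is (a *\<^sub>R f + b *\<^sub>R g) x = a * iter_deriv is f x + b * iter_deriv is g x"
proof (induction "is" arbitrary: x)
  case Nil
  then show ?case by simp
next
  case (Cons i "is")
  let ?F = "\<lambda>h t. iter_deriv is h (x + t *\<^sub>R axis i 1)"
  have d: "?F f field_differentiable (at 0)" "?F g field_differentiable (at 0)"
    using Cb_dirD[OF f, of "is" x i] Cb_dirD[OF g, of "is" x i] Cons.prems by simp_all
  have "\<forall>\<^sub>F t in nhds 0. ?F (a *\<^sub>R f + b *\<^sub>R g) t = a * ?F f t + b * ?F g t"
    using line_eventually[OF K Cons.prems(2), of "axis i 1"]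
    by (rule eventually_mono) (rule Cons.IH, use Cons.prems in simp_all)
  then have "deriv (?F (a *\<^sub>R f + b *\<^sub>R g)) 0 = deriv (\<lambda>t. a * ?F f t + b * ?F g t) 0"
    by (intro deriv_cong_ev) auto
  also have "\<dots> = a * deriv (?F f) 0 + b * deriv (?F g) 0"
    using d by (simp add: field_differentiable_mult)
  finally show ?case by (simp only: iter_deriv.simps partial_deriv_def)
qed

lemma Cb_lin:
  assumes K: "open K" and f: "f \<in> Cb k K" and g: "g \<in> Cb k K"
  shows "a *\<^sub>R f + b *\<^sub>R g \<in> Cb k K"
proof -
  let ?h = "a *\<^sub>R f + b *\<^sub>R g"
  have 1: "(\<lambda>t. iter_deriv is ?h (x + t *\<^sub>R axis i 1)) differentiable (at 0)"
    if "length is < k" "x \<in> K" for "is" i x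
  proof -
    have d: "(\<lambda>t. iter_deriv is f (x + t *\<^sub>R axis i 1)) differentiable (at 0)"
            "(\<lambda>t. iter_deriv is g (x + t *\<^sub>R axis i 1)) differentiable (at 0)"
      using f g that by (auto simp: Cb_def)
    have "(\<lambda>t. a * iter_deriv is f (x + t *\<^sub>R axis i 1)
             + b * iter_deriv is g (x + t *\<^sub>R axis i 1)) differentiable (at 0)"
      by (intro derivative_intros d)
    then obtain D where D: "((\<lambda>t. a * iter_deriv is f (x + t *\<^sub>R axis i 1)
             + b * iter_deriv is g (x + t *\<^sub>R axis i 1)) has_real_derivative D) (at 0)"
      by (auto simp: real_differentiable_def)
    have ev: "\<forall>\<^sub>F t in nhds 0. iter_deriv is ?h (x + t *\<^sub>R axis i 1)
        = a * iter_deriv is f (x + t *\<^sub>R axis i 1) + b * iter_deriv is g (x + t *\<^sub>R axis i 1)"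
      using line_eventually[OF K that(2), of "axis i 1"]
      by (rule eventually_mono) (use iter_deriv_lin[OF K f g] that in auto)
    have "((\<lambda>t. iter_deriv is ?h (x + t *\<^sub>R axis i 1)) has_real_derivative D) (at 0)"
      using DERIV_cong_ev[OF refl ev refl] D by blast
    then show ?thesis by (auto simp: real_differentiable_def)
  qed
  have 2: "continuous_on K (iter_deriv is ?h) \<and> bounded (iter_deriv is ?h ` K)"
    if l: "length is \<le> k" for "is"
  proof
    have cb: "continuous_on K (iter_deriv is f)" "continuous_on K (iter_deriv is g)"
      "bounded (iter_deriv is f ` K)" "bounded (iter_deriv is g ` K)"
      using f g l by (auto simp: Cb_def)
    have e: "iter_deriv is ?h x = a * iter_deriv is f x + b * iter_deriv is g x" if "x \<in> K" for x
      using iter_deriv_lin[OF K f g l that] .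
    have "continuous_on K (\<lambda>x. a * iter_deriv is f x + b * iter_deriv is g x)"
      by (intro continuous_intros cb)
    then show "continuous_on K (iter_deriv is ?h)"
      by (subst continuous_on_cong[OF refl e])
    obtain A B where "\<forall>x\<in>K. \<bar>iter_deriv is f x\<bar> \<le> A" "\<forall>x\<in>K. \<bar>iter_deriv is g x\<bar> \<le> B"
      using cb(3,4) unfolding bounded_iff by auto
    then have "\<bar>iter_deriv is ?h x\<bar> \<le> \<bar>a\<bar> * A + \<bar>b\<bar> * B" if "x \<in> K" for x
      unfolding e[OF that] using that
      by (intro order.trans[OF abs_triangle_ineq] add_mono)
         (auto simp: abs_mult intro!: mult_left_mono)
    then show "bounded (iter_deriv is ?h ` K)" unfolding bounded_iff by auto
  qed
  have "?h x = 0" if "x \<notin> K" for x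
    using f g that by (auto simp: Cb_def)
  then show ?thesis unfolding Cb_def using 1 2 by auto
qed

lemma zero_in_Cb: "(0 :: real ^ 'd \<Rightarrow> real) \<in> Cb k K"
proof -
  have "iter_deriv is (0 :: real ^ 'd \<Rightarrow> real) = (\<lambda>x. 0)" for "is"
    by (induction "is") (auto simp: partial_deriv_def fun_eq_iff)
  then show ?thesis by (auto simp: Cb_def intro!: boundedI[where B = 0])
qed

lemma subspace_Cb: "open K \<Longrightarrow> subspace (Cb k K)"
  unfolding subspace_def
  using zero_in_Cb Cb_lin[where a = 1 and b = 1] Cb_lin[where b = 0] by auto

lemma finite_lists_le: "finite {is :: 'd::finite list. length is \<le> k}"
  using finite_lists_length_le[of "UNIV :: 'd set"] by simp

lemma Cb_norm_upper:
  assumes "f \<in> Cb k K" "length is \<le> k" "x \<in> K"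
  shows "\<bar>iter_deriv is f x\<bar> \<le> Cb_norm k K f"
proof -
  have "bounded (iter_deriv is f ` K)" using assms by (auto simp: Cb_def)
  then have "bdd_above ((\<lambda>x. \<bar>iter_deriv is f x\<bar>) ` K)"
    by (auto simp: bounded_iff bdd_above_def)
  then have "\<bar>iter_deriv is f x\<bar> \<le> (SUP x\<in>K. \<bar>iter_deriv is f x\<bar>)"
    by (intro cSUP_upper assms)
  also have "\<dots> \<le> Cb_norm k K f"
    unfolding Cb_norm_def using assms by (intro Max_ge finite_imageI finite_lists_le) auto
  finally show ?thesis .
qed

lemma Cb_norm_least:
  assumes "K \<noteq> {}" "\<And>is x. length is \<le> k \<Longrightarrow> x \<in> K \<Longrightarrow> \<bar>iter_deriv is f x\<bar> \<le> C"
  shows "Cb_norm k K f \<le> C"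
proof -
  have "[] \<in> {is :: 'a list. length is \<le> k}" by simp
  then have ne: "{is :: 'a list. length is \<le> k} \<noteq> {}" by blast
  show ?thesis
    unfolding Cb_norm_def
    using assms ne by (subst Max_le_iff) (auto simp: finite_lists_le intro!: cSUP_least)
qed

lemma Metric_space_Cb:
  fixes K :: "(real ^ 'a) set"
  assumes K: "open K" "K \<noteq> {}"
  shows "Metric_space (Cb k K) (Cb_dist k K)"
proof
  have diff: "f - g \<in> Cb k K" if "f \<in> Cb k K" "g \<in> Cb k K" for f g
    using subspace_diff[OF subspace_Cb[OF K(1)]] that .
  have it: "iter_deriv is (f - g) x = iter_deriv is f x - iter_deriv is g x"
    if "f \<in> Cb k K" "g \<in> Cb k K" "length is \<le> k" "x \<in> K" for f g and "is" :: "'a list" and x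
    using iter_deriv_lin[OF K(1) that(1,2,3,4), of 1 "-1"] by simp
  have nn: "0 \<le> Cb_norm k K f" if "f \<in> Cb k K" for f
  proof -
    obtain x where "x \<in> K" using K(2) by blast
    then have "\<bar>f x\<bar> \<le> Cb_norm k K f" using Cb_norm_upper[OF that, of "[]" x] by simp
    then show ?thesis using abs_ge_zero[of "f x"] by linarith
  qed
  have le: "Cb_norm k K (f - g) \<le> Cb_norm k K (g - f)"
    if "f \<in> Cb k K" "g \<in> Cb k K" for f g
  proof (rule Cb_norm_least[OF K(2)])
    fix "is" :: "'a list" and x assume a: "length is \<le> k" "x \<in> K"
    show "\<bar>iter_deriv is (f - g) x\<bar> \<le> Cb_norm k K (g - f)"
      using Cb_norm_upper[OF diff[OF that(2,1)] a] it[OF that a] it[OF that(2,1) a] by simp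
  qed
  show "0 \<le> Cb_dist k K f g" for f g
    using nn diff by (auto simp: Cb_dist_def)
  show "Cb_dist k K f g = Cb_dist k K g f" for f g
    using le[of f g] le[of g f] by (auto simp: Cb_dist_def)
  show "Cb_dist k K f g = 0 \<longleftrightarrow> f = g" if fg: "f \<in> Cb k K" "g \<in> Cb k K" for f g
  proof
    assume "Cb_dist k K f g = 0"
    then have 0: "Cb_norm k K (f - g) = 0" using fg by (simp add: Cb_dist_def)
    show "f = g"
    proof
      fix x show "f x = g x"
      proof (cases "x \<in> K")
        case True
        then show ?thesis using Cb_norm_upper[OF diff[OF fg], of "[]" x] 0 by simp
      next
        case False
        then show ?thesis using fg by (simp add: Cb_def)
      qed
    qed
  next
    assume "f = g"
    then have "Cb_norm k K (f - g) \<le> 0"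
      using it[OF fg] by (intro Cb_norm_least[OF K(2)]) auto
    then show "Cb_dist k K f g = 0"
      using nn[OF diff[OF fg]] fg by (simp add: Cb_dist_def)
  qed
  show "Cb_dist k K f h \<le> Cb_dist k K f g + Cb_dist k K g h"
    if m: "f \<in> Cb k K" "g \<in> Cb k K" "h \<in> Cb k K" for f g h
  proof -
    have "Cb_norm k K (f - h) \<le> Cb_norm k K (f - g) + Cb_norm k K (g - h)"
    proof (rule Cb_norm_least[OF K(2)])
      fix "is" :: "'a list" and x assume a: "length is \<le> k" "x \<in> K"
      show "\<bar>iter_deriv is (f - h) x\<bar> \<le> Cb_norm k K (f - g) + Cb_norm k K (g - h)"
        using Cb_norm_upper[OF diff[OF m(1,2)] a] Cb_norm_upper[OF diff[OF m(2,3)] a]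
          it[OF m(1,2) a] it[OF m(2,3) a] it[OF m(1,3) a] by linarith
    qed
    then show ?thesis using m by (simp add: Cb_dist_def)
  qed
qed

end

theory Submission
  imports Defs
begin

text \<open>
  A function \<open>\<psi>t ! j\<close> with \<open>j < length N\<close> is dual to a node of \<open>N\<close>, so every node in \<open>L\<close>
  vanishes on it; the common kernel of these nodes in \<open>Pt\<close> is \<open>P\<close>, which is why the function
  lies in \<open>P\<close>. Its duality with the nodes in \<open>N\<close> is part of its duality with \<open>N @ L\<close>.
\<close>


theorem proposition4p3:
  fixes K :: "(real ^ 'd) set" and k :: nat
    and P Pt :: "(real ^ 'd \<Rightarrow> real) set"
    and N L :: "((real ^ 'd \<Rightarrow> real) \<Rightarrow> real) list"
    and \<psi>t :: "(real ^ 'd \<Rightarrow> real) list"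
  assumes "finite_element k K P N"
    and "fin_dim_subspace Pt" and "Pt \<subseteq> Cb k K" and "P \<subseteq> Pt"
    and "set L \<subseteq> top_dual k K (Cb k K)"
    and "lin_indep (map (restrict_to Pt) L)"
    and "P = Pt \<inter> (\<Inter>i<length L. {p \<in> Pt. (L ! i) p = 0})"
    and "finite_element k K Pt (N @ L)"
    and "nodal_basis Pt (N @ L) \<psi>t"
  shows "nodal_basis P N (take (length N) \<psi>t)"
proof -
  have len: "length \<psi>t = length N + length L"
    and sub: "set \<psi>t \<subseteq> Pt"
    and dual: "\<And>i j. i < length N + length L \<Longrightarrow> j < length N + length L \<Longrightarrow>
      ((N @ L) ! i) (\<psi>t ! j) = (if i = j then 1 else 0)"
    using \<open>nodal_basis Pt (N @ L) \<psi>t\<close> by (auto simp: nodal_basis_def)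
  have "\<psi>t ! j \<in> P" if j: "j < length N" for j
  proof -
    have "(L ! i) (\<psi>t ! j) = 0" if "i < length L" for i
      using dual[of "length N + i" j] that j by simp
    moreover have "\<psi>t ! j \<in> Pt"
      using sub len j by (simp add: subset_iff)
    ultimately show ?thesis
      by (subst \<open>P = _\<close>) simp
  qed
  then have "set (take (length N) \<psi>t) \<subseteq> P"
    by (auto simp: in_set_conv_nth)
  moreover have "(N ! i) (\<psi>t ! j) = (if i = j then 1 else 0)"
    if "i < length N" "j < length N" for i j
    using dual[of i j] that by (simp add: nth_append)
  ultimately show ?thesis
    using len by (simp add: nodal_basis_def)
qed

end
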